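(* In the noncooperative scenario, the probability $\mathcal A_{\mathrm{SBS}}$ that the typical user (at the origin) is associated with a single small base station is $$\mathcal A_{\mathrm{SBS}}=\frac{1}{1+\dfrac{1}{\hat\lambda_s}\,\dfrac{1}{\left(\hat p_s\hat\Delta_s\hat B_s\right)^{2/\alpha}}},\qquad \hat\lambda_s=\lambda_s/\lambda_m .$$
   Context: Macro base stations (MBSs) and small base stations (SBSs) form independent homogeneous Poisson point processes $\Phi_m,\Phi_s$ on $\mathbb R^2$ with densities $\lambda_m,\lambda_s>0$. For $j\in\{m,s\}$ let $p_j>0$ be the transmit power, $M_j\ge\Psi_j\ge1$ integers (number of antennas and number of served users), $\Delta_j=M_j-\Psi_j+1$, and $B_j>0$ the bias. Both tiers have the same path-loss exponent $\alpha>2$. Put $\hat p_s=p_s/p_m$, $\hat\Delta_s=\Delta_s/\Delta_m$, $\hat B_s=B_s/B_m$. The average received power from a tier-$j$ base station at distance $r$ is $p_j\Delta_j r^{-\alpha}$. Let $r_m$ and $r_s$ be the distances from the origin to the nearest MBS and the nearest SBS. In the noncooperative scenario the typical user is associated with the nearest SBS if $B_sp_s\Delta_s r_s^{-\alpha}>B_mp_m\Delta_m r_m^{-\alpha}$, and with the nearest MBS otherwise. *)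

theory Defs
  imports "HOL-Probability.Probability"
begin

(* Simple point processes are modelled as random locally finite subsets of the plane.
   The Poisson law of the number of points is written out instead of using poisson_pmf,
   because poisson_pmf is specified only for positive rates and A may be a null set
   (then 0 ^ 0 = 1 says that A almost surely contains no point). *)
locale homogeneous_poisson_process = prob_space M
  for M :: "'w measure" and \<Phi> :: "'w \<Rightarrow> (real^2) set" and density :: real +
  assumes density_pos: "density > 0"
    and locally_finite:
      "\<And>\<omega> A. \<omega> \<in> space M \<Longrightarrow> bounded A \<Longrightarrow> finite (\<Phi> \<omega> \<inter> A)"
    and count_measurable:
      "\<And>A. A \<in> sets borel \<Longrightarrow> bounded A \<Longrightarrow>
        random_variable (count_space UNIV) (\<lambda>\<omega>. card (\<Phi> \<omega> \<inter> A))"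
    and count_poisson:
      "\<And>A k. A \<in> sets borel \<Longrightarrow> bounded A \<Longrightarrow>
        prob {\<omega> \<in> space M. card (\<Phi> \<omega> \<inter> A) = k} =
          (density * measure lborel A) ^ k / fact k * exp (- (density * measure lborel A))"
    and count_indep:
      "\<And>(n::nat) A. disjoint_family_on A {..<n} \<Longrightarrow>
        (\<And>i. i < n \<Longrightarrow> A i \<in> sets borel \<and> bounded (A i)) \<Longrightarrow>
        indep_vars (\<lambda>_. count_space UNIV) (\<lambda>i \<omega>. card (\<Phi> \<omega> \<inter> A i)) {..<n}"

(* The sigma-algebra on the sample space generated by a point process. *)
definition process_events :: "'w measure \<Rightarrow> ('w \<Rightarrow> (real^2) set) \<Rightarrow> 'w set set" where
  "process_events M \<Phi> = sigma_sets (space M)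
     {{\<omega> \<in> space M. card (\<Phi> \<omega> \<inter> A) = k} |A k. A \<in> sets borel \<and> bounded A}"

datatype tier = MBS | SBS

definition antenna_gain :: "nat \<Rightarrow> nat \<Rightarrow> real" where
  "antenna_gain antennas users = real antennas - real users + 1"

definition avg_received_power :: "real \<Rightarrow> real \<Rightarrow> real \<Rightarrow> real \<Rightarrow> real" where
  "avg_received_power \<alpha> p \<Delta> r = p * \<Delta> * r powr (- \<alpha>)"

(* For a locally finite nonempty set the infimum in infdist is attained.  The library
   convention infdist x {} = 0 matters only on a null event, as a homogeneous Poisson
   process of positive density is almost surely nonempty. *)
definition nearest_distance :: "(real^2) set \<Rightarrow> real" where
  "nearest_distance X = infdist 0 X"

(* The tier whose nearest base station serves the user at the origin, for given
   configurations X MBS and X SBS of the base stations. *)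
definition noncoop_association ::
  "real \<Rightarrow> (tier \<Rightarrow> real) \<Rightarrow> (tier \<Rightarrow> real) \<Rightarrow> (tier \<Rightarrow> real) \<Rightarrow> (tier \<Rightarrow> (real^2) set) \<Rightarrow> tier"
where
  "noncoop_association \<alpha> p \<Delta> B X =
    (if B SBS * avg_received_power \<alpha> (p SBS) (\<Delta> SBS) (nearest_distance (X SBS))
        > B MBS * avg_received_power \<alpha> (p MBS) (\<Delta> MBS) (nearest_distance (X MBS))
     then SBS else MBS)"

end

theory Submission
  imports Defs
begin

text \<open>
  By the void probabilities of a Poisson process, the squared distance to the nearest point is
  exponentially distributed with rate \<open>\<pi> \<lambda>\<close>. Up to null events the user is served by an SBS iff
  \<open>r\<^sub>s\<^sup>2 < \<kappa> r\<^sub>m\<^sup>2\<close> with \<open>\<kappa>\<close> the ratio of the biased gains to the power \<open>2 / \<alpha>\<close>, so the claim reduces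
  to comparing two independent exponential variables.
\<close>

section \<open>Comparison of two independent exponential variables\<close>

text \<open>Conditioning on \<open>X = x\<close> leaves the tail probability
  \<open>exp (- (x / c) * u)\<close> of \<open>Y\<close> beyond \<open>x / c\<close>. Weighted with
  the density of \<open>X\<close>, this tail is again an exponential density up to a constant
  factor, and that factor is the answer.\<close>

lemma (in prob_space) exponential_distributed_less:
  fixes X Y :: "'a \<Rightarrow> real"
  assumes [arith]: "0 < l" "0 < u" "0 < c"
    and X: "distributed M lborel X (exponential_density l)"
    and Y: "distributed M lborel Y (exponential_density u)"
    and indep: "indep_var borel X borel Y"
  shows "\<P>(x in M. X x < c * Y x) = l / (l + u / c)"
proof -
  have mX[measurable]: "random_variable borel X" and mY[measurable]: "random_variable borel Y"
    using X Y by (simp_all add: exponential_distributed_iff)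
  interpret DX: prob_space "distr M borel X" by (rule prob_space_distr) fact
  interpret DY: prob_space "distr M borel Y" by (rule prob_space_distr) fact
  let ?A = "{(x, y). x < c * y} :: (real \<times> real) set"
  have A: "?A \<in> sets (borel \<Otimes>\<^sub>M borel)"
  proof -
    have "{z \<in> space (borel \<Otimes>\<^sub>M borel). fst z < c * snd z} \<in> sets (borel \<Otimes>\<^sub>M borel)"
      by measurable
    then show ?thesis
      by (simp add: space_pair_measure case_prod_unfold)
  qed
  have dX: "distr M borel X = density lborel (exponential_density l)"
    using distributed_distr_eq_density[OF X] by (simp cong: distr_cong)
  have slice: "emeasure (distr M borel Y) (Pair x -` ?A) = ennreal (exp (- (x / c) * u))"
    if "0 \<le> x" for x
  proof -
    have "Pair x -` ?A = {x / c <..}"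
      by (auto simp: field_simps)
    then have "emeasure (distr M borel Y) (Pair x -` ?A) = \<P>(\<omega> in M. x / c < Y \<omega>)"
      by (simp add: emeasure_distr emeasure_eq_measure vimage_def Int_def conj_commute)
    then show ?thesis
      using exponential_distributedD_gt[OF Y, of "x / c"] that by simp
  qed
  let ?r = "l + u / c"
  have r: "0 < ?r"
    by (simp add: add_pos_pos)
  \<comment> \<open>The product of density and tail is rewritten as \<open>l / ?r\<close> times a
    probability density, so that no integral has to be evaluated later. For negative
    \<open>x\<close> both sides vanish, which is why \<open>slice\<close> is needed only for
    \<open>0 \<le> x\<close>.\<close>
  have dens: "ennreal (exponential_density l x) * emeasure (distr M borel Y) (Pair x -` ?A) =
      ennreal (l / ?r) * ennreal (exponential_density ?r x)" for x
  proof (cases "x < 0")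
    case False
    then have "exponential_density l x * exp (- (x / c) * u) = l / ?r * exponential_density ?r x"
      using r by (simp add: exponential_density_def exp_add[symmetric] distrib_left mult.assoc)
    moreover have "0 \<le> l / ?r"
      using r by simp
    ultimately show ?thesis
      using False r by (subst slice) (simp_all only: ennreal_mult[symmetric] not_less
          exponential_density_nonneg \<open>0 < l\<close> exp_ge_zero)
  qed (simp add: exponential_density_def)
  have "emeasure M {\<omega> \<in> space M. X \<omega> < c * Y \<omega>} =
      emeasure (distr M (borel \<Otimes>\<^sub>M borel) (\<lambda>\<omega>. (X \<omega>, Y \<omega>))) ?A"
    using A by (subst emeasure_distr) (auto intro!: arg_cong[where f="emeasure M"])
  also have "\<dots> = emeasure (distr M borel X \<Otimes>\<^sub>M distr M borel Y) ?A"
    using indep by (simp add: indep_var_distribution_eq)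
  also have "\<dots> = (\<integral>\<^sup>+x. emeasure (distr M borel Y) (Pair x -` ?A) \<partial>distr M borel X)"
    using A by (intro DY.emeasure_pair_measure_alt) (simp cong: sets_pair_measure_cong)
  also have "\<dots> = (\<integral>\<^sup>+x. exponential_density l x * emeasure (distr M borel Y) (Pair x -` ?A) \<partial>lborel)"
  proof -
    have "(\<lambda>x. emeasure (distr M borel Y) (Pair x -` ?A)) \<in> borel_measurable borel"
      by (rule DY.measurable_emeasure_Pair) (use A in \<open>simp cong: sets_pair_measure_cong\<close>)
    then show ?thesis
      unfolding dX by (intro nn_integral_density) auto
  qed
  also have "\<dots> = (\<integral>\<^sup>+x. ennreal (l / ?r) * ennreal (exponential_density ?r x) \<partial>lborel)"
    by (simp only: dens)
  also have "\<dots> = ennreal (l / ?r) * emeasure (density lborel (exponential_density ?r)) UNIV"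
    by (simp add: nn_integral_cmult emeasure_density)
  also have "\<dots> = ennreal (l / ?r)"
    using prob_space.emeasure_space_1[OF prob_space_exponential_density[OF r]] by simp
  finally show ?thesis
    using r by (simp add: measure_def)
qed

section \<open>The distance to the nearest point of a locally finite set\<close>

text \<open>A locally finite set has no limit points, hence is closed, so the infimum is attained.
  Without attainment the distance could equal \<open>r\<close> while the closed ball misses
  \<open>X\<close>.\<close>

lemma infdist_le_iff_locally_finite:
  fixes X :: "'a::euclidean_space set"
  assumes fin: "\<And>A. bounded A \<Longrightarrow> finite (X \<inter> A)" and "X \<noteq> {}"
  shows "infdist x X \<le> r \<longleftrightarrow> X \<inter> cball x r \<noteq> {}"
proof -
  have "\<not> y islimpt X" for y
    unfolding islimpt_eq_infinite_cball using fin[of "cball y 1"] by (auto intro!: exI[of _ 1])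
  then have "closed X"
    by (simp add: closed_limpt)
  then obtain y where y: "y \<in> X" "infdist x X = dist x y"
    using infdist_attains_inf \<open>X \<noteq> {}\<close> by blast
  show ?thesis
  proof
    assume "infdist x X \<le> r"
    with y show "X \<inter> cball x r \<noteq> {}"
      by auto
  next
    assume "X \<inter> cball x r \<noteq> {}"
    then obtain z where "z \<in> X" "dist x z \<le> r"
      by auto
    then show "infdist x X \<le> r"
      using infdist_le2 by blast
  qed
qed

section \<open>Void probabilities and the law of the nearest distance\<close>

context homogeneous_poisson_process
begin

lemma process_events_subset: "process_events M \<Phi> \<subseteq> events"
  unfolding process_events_def
proof (rule sets.sigma_sets_subset, safe)
  fix A k assume "A \<in> sets (borel :: (real^2) measure)" "bounded A"
  from measurable_sets[OF count_measurable[OF this], of "{k}"]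
  show "{\<omega> \<in> space M. card (\<Phi> \<omega> \<inter> A) = k} \<in> events"
    by (simp add: vimage_def Int_def conj_commute)
qed

text \<open>Membership in \<open>process_events\<close> rather than just \<open>events\<close> is
  what later transfers the independence of the tiers to the distances. Local finiteness enters
  because \<open>card\<close> is also 0 on infinite sets.\<close>

lemma void_events: "{\<omega> \<in> space M. \<Phi> \<omega> \<inter> cball 0 r = {}} \<in> process_events M \<Phi>"
proof -
  have "{\<omega> \<in> space M. \<Phi> \<omega> \<inter> cball 0 r = {}} = {\<omega> \<in> space M. card (\<Phi> \<omega> \<inter> cball 0 r) = 0}"
    using locally_finite[of _ "cball 0 r"] by (auto simp: card_eq_0_iff simp del: mem_cball_0)
  then show ?thesis
    unfolding process_events_def by (auto intro!: sigma_sets.Basic)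
qed

text \<open>This is the Poisson weight at 0 for a disc of area
  \<open>pi * r\<^sup>2\<close>.\<close>

lemma prob_void:
  assumes "0 \<le> r"
  shows "prob {\<omega> \<in> space M. \<Phi> \<omega> \<inter> cball 0 r = {}} = exp (- (density * pi) * r\<^sup>2)"
proof -
  have "{\<omega> \<in> space M. \<Phi> \<omega> \<inter> cball 0 r = {}} = {\<omega> \<in> space M. card (\<Phi> \<omega> \<inter> cball 0 r) = 0}"
    using locally_finite[of _ "cball 0 r"] by (auto simp: card_eq_0_iff simp del: mem_cball_0)
  then show ?thesis
    using count_poisson[of "cball 0 r" 0] content_cball[OF assms, of "0 :: real^2"]
    by (simp add: unit_ball_vol_2 mult.assoc)
qed

lemma empty_eq_Inter_void:
  "{\<omega> \<in> space M. \<Phi> \<omega> = {}} = (\<Inter>n. {\<omega> \<in> space M. \<Phi> \<omega> \<inter> cball 0 (real n) = {}})"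
proof -
  have "\<Phi> \<omega> = {}" if "\<And>n. \<Phi> \<omega> \<inter> cball 0 (real n) = {}" for \<omega>
    using that real_arch_simple by (metis disjoint_iff equals0I mem_cball_0)
  then show ?thesis
    by auto
qed

text \<open>An empty configuration leaves every disc of radius \<open>n\<close> void, and the void
  probabilities tend to 0. This makes the value of \<open>infdist\<close> at the empty set
  harmless.\<close>

lemma prob_empty: "prob {\<omega> \<in> space M. \<Phi> \<omega> = {}} = 0"
proof -
  have "prob {\<omega> \<in> space M. \<Phi> \<omega> = {}} \<le> exp (- (density * pi) * (real n)\<^sup>2)" for n
    unfolding prob_void[OF of_nat_0_le_iff, symmetric]
    using void_events process_events_subset by (intro finite_measure_mono) auto
  moreover have "(\<lambda>n. exp (- (density * pi) * (real n)\<^sup>2)) \<longlonglongrightarrow> 0"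
  proof -
    have "filterlim (\<lambda>n. (density * pi) * (real n)\<^sup>2) at_top sequentially"
      using density_pos
      by (intro filterlim_tendsto_pos_mult_at_top[OF tendsto_const] filterlim_pow_at_top
          filterlim_real_sequentially) auto
    then show ?thesis
      by (auto intro!: filterlim_compose[OF exp_at_bot] simp: filterlim_uminus_at_top)
  qed
  ultimately have "prob {\<omega> \<in> space M. \<Phi> \<omega> = {}} \<le> 0"
    by (intro LIMSEQ_le_const) auto
  then show ?thesis
    by (simp add: measure_le_0_iff)
qed

lemma nearest_distance_measurable:
  "(\<lambda>\<omega>. nearest_distance (\<Phi> \<omega>)) \<in> borel_measurable (sigma (space M) (process_events M \<Phi>))"
proof -
  let ?F = "sigma (space M) (process_events M \<Phi>)"
  have sub: "process_events M \<Phi> \<subseteq> Pow (space M)"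
    using process_events_subset sets.sets_into_space by blast
  have void: "{\<omega> \<in> space M. \<Phi> \<omega> \<inter> cball 0 r = {}} \<in> sets ?F" for r
    using void_events sub by auto
  have empty: "{\<omega> \<in> space M. \<Phi> \<omega> = {}} \<in> sets ?F"
    unfolding empty_eq_Inter_void using void by (intro sets.countable_INT) auto
  have "{\<omega> \<in> space ?F. nearest_distance (\<Phi> \<omega>) \<le> r} \<in> sets ?F" for r
  proof (cases "r < 0")
    case True
    then have "{\<omega> \<in> space ?F. nearest_distance (\<Phi> \<omega>) \<le> r} = {}"
      using infdist_nonneg order_trans by (fastforce simp: nearest_distance_def not_le)
    then show ?thesis
      by (simp only: sets.empty_sets)
  next
    case False
    \<comment> \<open>The first disjunct reflects the convention \<open>infdist 0 {} = 0\<close>.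
      Measurability must hold on the whole sample space, so the null event of an empty configuration
      cannot be dropped here.\<close>
    have iff: "nearest_distance (\<Phi> \<omega>) \<le> r \<longleftrightarrow> \<Phi> \<omega> = {} \<or> \<Phi> \<omega> \<inter> cball 0 r \<noteq> {}"
      if "\<omega> \<in> space M" for \<omega>
      using False infdist_le_iff_locally_finite[OF locally_finite[OF that]]
      by (cases "\<Phi> \<omega> = {}") (simp add: nearest_distance_def infdist_def, simp add: nearest_distance_def)
    then have "{\<omega> \<in> space ?F. nearest_distance (\<Phi> \<omega>) \<le> r} =
        {\<omega> \<in> space M. \<Phi> \<omega> = {}} \<union> (space ?F - {\<omega> \<in> space M. \<Phi> \<omega> \<inter> cball 0 r = {}})"
      using sub by (auto simp: space_measure_of)
    then show ?thesis
      using void empty by (auto intro!: sets.Un sets.compl_sets)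
  qed
  then show ?thesis
    by (simp add: borel_measurable_iff_le)
qed

lemma nearest_distance_rv: "random_variable borel (\<lambda>\<omega>. nearest_distance (\<Phi> \<omega>))"
proof -
  have "process_events M \<Phi> \<subseteq> Pow (space M)"
    using process_events_subset sets.sets_into_space by blast
  then have "sets (sigma (space M) (process_events M \<Phi>)) \<subseteq> events"
    using sets.sigma_sets_subset[OF process_events_subset] by simp
  then show ?thesis
    using measurable_mono[OF order_refl refl, of "sigma (space M) (process_events M \<Phi>)" M]
      nearest_distance_measurable \<open>process_events M \<Phi> \<subseteq> Pow (space M)\<close>
    by (auto simp: space_measure_of)
qed

text \<open>The squared distance exceeds \<open>a\<close> exactly when the disc of radius
  \<open>sqrt a\<close> is void, apart from the null event of an empty configuration. Squaring makes
  the area of the disc linear in \<open>a\<close>, which turns the void probability into an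
  exponential tail.\<close>

lemma nearest_distance_sq_exponential:
  "distributed M lborel (\<lambda>\<omega>. (nearest_distance (\<Phi> \<omega>))\<^sup>2) (exponential_density (density * pi))"
proof (rule exponential_distributedI)
  note [measurable] = nearest_distance_rv
  show "random_variable borel (\<lambda>\<omega>. (nearest_distance (\<Phi> \<omega>))\<^sup>2)"
    by measurable
  show "0 < density * pi"
    using density_pos by simp
  fix a :: real assume a: "0 \<le> a"
  let ?V = "{\<omega> \<in> space M. \<Phi> \<omega> \<inter> cball 0 (sqrt a) = {}}"
  let ?E = "{\<omega> \<in> space M. \<Phi> \<omega> = {}}"
  have V: "?V \<in> events" and E: "?E \<in> events"
    using void_events process_events_subset unfolding empty_eq_Inter_void
    by (auto intro!: sets.countable_INT)
  have "(nearest_distance (\<Phi> \<omega>))\<^sup>2 \<le> a \<longleftrightarrow> \<Phi> \<omega> = {} \<or> \<Phi> \<omega> \<inter> cball 0 (sqrt a) \<noteq> {}"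
    if "\<omega> \<in> space M" for \<omega>
  proof -
    have "(nearest_distance (\<Phi> \<omega>))\<^sup>2 \<le> a \<longleftrightarrow> nearest_distance (\<Phi> \<omega>) \<le> sqrt a"
      using a real_le_rsqrt sqrt_le_D
      by (metis infdist_nonneg nearest_distance_def power_mono real_sqrt_pow2)
    then show ?thesis
      using a infdist_le_iff_locally_finite[OF locally_finite[OF that]]
      by (cases "\<Phi> \<omega> = {}") (simp add: nearest_distance_def infdist_def, simp add: nearest_distance_def)
  qed
  then have "{\<omega> \<in> space M. (nearest_distance (\<Phi> \<omega>))\<^sup>2 \<le> a} = (space M - ?V) \<union> ?E"
    by auto
  moreover have "prob ((space M - ?V) \<union> ?E) = prob (space M - ?V)"
    using V E prob_empty by (intro measure_Un_null_set) (auto simp: emeasure_eq_measure)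
  ultimately show "emeasure M {\<omega> \<in> space M. (nearest_distance (\<Phi> \<omega>))\<^sup>2 \<le> a} =
      1 - ennreal (exp (- a * (density * pi)))"
    using V a prob_void[of "sqrt a"]
    by (simp add: emeasure_eq_measure prob_compl mult.commute ennreal_minus ennreal_1[symmetric]
        del: ennreal_1)
qed

text \<open>An exponential variable is almost surely positive. This excludes distance 0, where
  \<open>0 powr (- \<alpha>) = 0\<close> would assign zero received power to a base station at the
  origin.\<close>

lemma AE_nearest_distance_pos: "AE \<omega> in M. 0 < nearest_distance (\<Phi> \<omega>)"
proof -
  note [measurable] = nearest_distance_rv
  have "\<P>(\<omega> in M. 0 < (nearest_distance (\<Phi> \<omega>))\<^sup>2) = 1"
    using exponential_distributedD_gt[OF nearest_distance_sq_exponential, of 0] density_pos by simp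
  then have "AE \<omega> in M. 0 < (nearest_distance (\<Phi> \<omega>))\<^sup>2"
    by (subst (asm) prob_Collect_eq_1) auto
  then show ?thesis
    by eventually_elim (use infdist_nonneg in \<open>auto simp: nearest_distance_def less_le\<close>)
qed

end

section \<open>Independence of the two tiers and the association rule\<close>

text \<open>A variable measurable with respect to the sigma-algebra of a process generates a
  sub-sigma-algebra of it, and independence passes to subfamilies.\<close>

lemma (in prob_space) indep_var_of_process_events:
  assumes X: "X \<in> measurable (sigma (space M) (process_events M \<Phi>)) S"
    and Y: "Y \<in> measurable (sigma (space M) (process_events M \<Psi>)) T"
    and indep: "indep_set (process_events M \<Phi>) (process_events M \<Psi>)"
  shows "indep_var S X T Y"
proof -
  have aux: "Z \<in> measurable M U \<and>
      sigma_sets (space M) {Z -` A \<inter> space M |A. A \<in> sets U} \<subseteq> process_events M \<Theta>"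
    if Z: "Z \<in> measurable (sigma (space M) (process_events M \<Theta>)) U"
      and sub: "process_events M \<Theta> \<subseteq> events" for Z U and \<Theta> :: "'a \<Rightarrow> (real^2) set"
  proof -
    have pow: "process_events M \<Theta> \<subseteq> Pow (space M)"
      using sub sets.sets_into_space by blast
    \<comment> \<open>Since \<open>process_events\<close> is already closed as a sigma-algebra,
      \<open>sigma\<close> adds no sets to it, and preimages under \<open>Z\<close> lie in
      \<open>process_events\<close> itself.\<close>
    have algebra: "sigma_algebra (space M) (process_events M \<Theta>)"
      unfolding process_events_def by (rule sigma_algebra_sigma_sets) auto
    have "Z -` A \<inter> space M \<in> process_events M \<Theta>" if "A \<in> sets U" for A
      using measurable_sets[OF Z that] pow sigma_algebra.sigma_sets_eq[OF algebra]
      by (simp add: space_measure_of sets_measure_of)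
    then show ?thesis
      using Z sub pow sigma_algebra.sigma_sets_subset[OF algebra, of "{Z -` A \<inter> space M |A. A \<in> sets U}"]
      by (auto simp: measurable_def space_measure_of)
  qed
  have sub: "process_events M \<Phi> \<subseteq> events" "process_events M \<Psi> \<subseteq> events"
    using indep by (auto dest: indep_setD_ev1 indep_setD_ev2)
  show ?thesis
    unfolding indep_var_eq indep_set_def
    using aux[OF X sub(1)] aux[OF Y sub(2)]
    by (auto intro!: indep_sets_mono_sets[OF indep[unfolded indep_set_def]] split: bool.splits)
qed

text \<open>After clearing the negative powers, both sides are raised to the power
  \<open>2 / \<alpha>\<close>, which is strictly increasing on positive reals and turns
  \<open>r powr \<alpha>\<close> into \<open>r\<^sup>2\<close>.\<close>

lemma mult_powr_neg_less_iff:
  fixes a b r s \<alpha> :: real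
  assumes "0 < a" "0 < b" "0 < r" "0 < s" "0 < \<alpha>"
  shows "b * s powr (- \<alpha>) < a * r powr (- \<alpha>) \<longleftrightarrow> r\<^sup>2 < (a / b) powr (2 / \<alpha>) * s\<^sup>2"
proof -
  have "b * s powr (- \<alpha>) < a * r powr (- \<alpha>) \<longleftrightarrow> r powr \<alpha> < (a / b) * s powr \<alpha>"
    using assms by (simp add: powr_minus field_simps)
  also have "\<dots> \<longleftrightarrow> (r powr \<alpha>) powr (2 / \<alpha>) < ((a / b) * s powr \<alpha>) powr (2 / \<alpha>)"
  proof -
    have pos: "0 < 2 / \<alpha>" "0 < r powr \<alpha>" "0 < (a / b) * s powr \<alpha>"
      using assms by simp_all
    show ?thesis
      using powr_less_mono2[OF pos(1) less_imp_le[OF pos(2)]] powr_less_cancel2[OF pos] by blast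
  qed
  also have "\<dots> \<longleftrightarrow> r\<^sup>2 < (a / b) powr (2 / \<alpha>) * s\<^sup>2"
    using assms powr_mult[of "a / b" "s powr \<alpha>" "2 / \<alpha>"]
    by (simp add: powr_powr powr_numeral)
  finally show ?thesis .
qed

theorem corollary1:
  fixes P :: "'w measure"
    and \<Phi> :: "tier \<Rightarrow> 'w \<Rightarrow> (real^2) set"
    and dens p B \<Delta> :: "tier \<Rightarrow> real"
    and M \<Psi> :: "tier \<Rightarrow> nat"
    and \<alpha> :: real
  assumes "\<And>j. homogeneous_poisson_process P (\<Phi> j) (dens j)"
    and "prob_space.indep_set P (process_events P (\<Phi> MBS)) (process_events P (\<Phi> SBS))"
    and "\<And>j. dens j > 0"
    and "\<And>j. p j > 0"
    and "\<And>j. M j \<ge> \<Psi> j"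
    and "\<And>j. \<Psi> j \<ge> 1"
    and "\<And>j. \<Delta> j = antenna_gain (M j) (\<Psi> j)"
    and "\<And>j. B j > 0"
    and "\<alpha> > 2"
  shows "measure P {\<omega> \<in> space P. noncoop_association \<alpha> p \<Delta> B (\<lambda>j. \<Phi> j \<omega>) = SBS} =
    1 / (1 + 1 / (dens SBS / dens MBS) *
      (1 / ((p SBS / p MBS) * (\<Delta> SBS / \<Delta> MBS) * (B SBS / B MBS)) powr (2 / \<alpha>)))"
proof -
  interpret m: homogeneous_poisson_process P "\<Phi> MBS" "dens MBS" by (rule assms(1))
  interpret s: homogeneous_poisson_process P "\<Phi> SBS" "dens SBS" by (rule assms(1))
  define R where "R j \<omega> = nearest_distance (\<Phi> j \<omega>)" for j \<omega>
  define g where "g j = B j * (p j * \<Delta> j)" for j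
  define \<kappa> where "\<kappa> = (g SBS / g MBS) powr (2 / \<alpha>)"
  \<comment> \<open>Serving at most as many users as there are antennas gives a gain of at least
    1.\<close>
  have \<Delta>: "\<Delta> j > 0" for j
    using assms(5)[of j] by (simp add: assms(7) antenna_gain_def)
  then have g: "g j > 0" for j
    using assms(4,8)[of j] by (simp add: g_def)
  then have \<kappa>: "\<kappa> > 0"
    by (simp add: \<kappa>_def less_imp_neq[THEN not_sym])
  have [measurable]: "R j \<in> borel_measurable P" for j
    by (cases j) (simp_all add: R_def[abs_def] m.nearest_distance_rv s.nearest_distance_rv)
  have assoc: "noncoop_association \<alpha> p \<Delta> B (\<lambda>j. \<Phi> j \<omega>) = SBS \<longleftrightarrow>
      g MBS * R MBS \<omega> powr (- \<alpha>) < g SBS * R SBS \<omega> powr (- \<alpha>)" for \<omega>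
    by (simp add: noncoop_association_def avg_received_power_def R_def g_def mult.assoc)
  have "measure P {\<omega> \<in> space P. noncoop_association \<alpha> p \<Delta> B (\<lambda>j. \<Phi> j \<omega>) = SBS} =
      \<P>(\<omega> in P. (R SBS \<omega>)\<^sup>2 < \<kappa> * (R MBS \<omega>)\<^sup>2)"
    unfolding assoc
  \<comment> \<open>The two events agree only where both distances are positive, hence almost
    surely.\<close>
  proof (rule m.finite_measure_eq_AE)
    show "AE \<omega> in P. \<omega> \<in> {\<omega> \<in> space P. g MBS * R MBS \<omega> powr (- \<alpha>) < g SBS * R SBS \<omega> powr (- \<alpha>)}
        \<longleftrightarrow> \<omega> \<in> {\<omega> \<in> space P. (R SBS \<omega>)\<^sup>2 < \<kappa> * (R MBS \<omega>)\<^sup>2}"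
      using m.AE_nearest_distance_pos s.AE_nearest_distance_pos
    proof eventually_elim
      case (elim \<omega>)
      then show ?case
        using mult_powr_neg_less_iff[OF g g, of "R SBS \<omega>" "R MBS \<omega>" \<alpha> MBS SBS] assms(9)
        by (simp add: R_def \<kappa>_def)
    qed
  qed measurable
  also have "\<dots> = dens SBS * pi / (dens SBS * pi + dens MBS * pi / \<kappa>)"
  proof (rule m.exponential_distributed_less)
    show "m.indep_var borel (\<lambda>\<omega>. (R SBS \<omega>)\<^sup>2) borel (\<lambda>\<omega>. (R MBS \<omega>)\<^sup>2)"
    proof -
      \<comment> \<open>The comparison of exponentials takes the SBS variable first, whereas
        independence is assumed with the MBS process first.\<close>
      have "m.indep_set (process_events P (\<Phi> SBS)) (process_events P (\<Phi> MBS))"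
      proof (rule m.indep_setI)
        fix a b assume "a \<in> process_events P (\<Phi> SBS)" "b \<in> process_events P (\<Phi> MBS)"
        with m.indep_setD[OF assms(2), of b a] show "m.prob (a \<inter> b) = m.prob a * m.prob b"
          by (simp add: Int_commute mult.commute)
      qed (rule s.process_events_subset m.process_events_subset)+
      then have "m.indep_var borel (R SBS) borel (R MBS)"
        unfolding R_def[abs_def]
        by (rule m.indep_var_of_process_events[OF s.nearest_distance_measurable
            m.nearest_distance_measurable])
      from m.indep_var_compose[OF this, of "\<lambda>x. x\<^sup>2" borel "\<lambda>x. x\<^sup>2" borel]
      show ?thesis
        by (simp add: comp_def)
    qed
  qed (use assms(3) \<kappa> in \<open>auto simp: R_def m.nearest_distance_sq_exponential
      s.nearest_distance_sq_exponential\<close>)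
  \<comment> \<open>Both rates carry the factor \<open>pi\<close>, which is pulled out to cancel, so
    that only the ratio of the densities remains.\<close>
  also have "\<dots> = (pi * dens SBS) / (pi * (dens SBS + dens MBS / \<kappa>))"
    by (simp add: distrib_left mult.commute)
  also have "\<dots> = dens SBS / (dens SBS + dens MBS / \<kappa>)"
    by simp
  also have "\<dots> = 1 / (1 + 1 / (dens SBS / dens MBS) * (1 / \<kappa>))"
    using assms(3)[of SBS] assms(3)[of MBS] \<kappa> by (simp add: field_simps)
  also have "\<kappa> = ((p SBS / p MBS) * (\<Delta> SBS / \<Delta> MBS) * (B SBS / B MBS)) powr (2 / \<alpha>)"
    by (simp add: \<kappa>_def g_def mult_ac)
  finally show ?thesis .
qed

end
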